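(* For integers $m,n$ with $4 \leqslant m\leqslant \frac{3n-15}{4}$, $\kappa^s(AQ_n; K_{1,m})=\kappa(AQ_n; K_{1,m})=\left\lceil\frac{n-1}{2}\right\rceil$.
   Context: All graphs are finite, simple and undirected. The $n$-dimensional augmented cube $AQ_n$ has as vertices all $n$-bit binary strings $a_na_{n-1}\ldots a_1$. $AQ_1=K_2$. For $n\geqslant 2$, $AQ_n$ is obtained from two copies $AQ^0_{n-1}$ (vertices $0a_{n-1}\ldots a_1$) and $AQ^1_{n-1}$ (vertices $1b_{n-1}\ldots b_1$) of $AQ_{n-1}$ by joining $0a_{n-1}\ldots a_1$ to $1b_{n-1}\ldots b_1$ iff either $a_i=b_i$ for all $1\leqslant i\leqslant n-1$ or $a_i=1-b_i$ for all $1\leqslant i\leqslant n-1$. Equivalently, for $u=u_n\ldots u_1$, writing $u^i$ for $u$ with bit $i$ flipped and $\overline{u}^i$ for $u$ with bits $1,\ldots,i$ all flipped, $N_{AQ_n}(u)=\{u^i:1\leqslant i\leqslant n\}\cup\{\overline{u}^i:2\leqslant i\leqslant n\}$. $K_{1,m}$ denotes the star with $m$ leaves. For a set $F$ of subgraphs of a graph $G$, let $V(F)$ be the set of vertices contained in some member of $F$; $F$ is a subgraph cut of $G$ if $G-V(F)$ is disconnected or consists of a single vertex. For a connected graph $H$, an $H$-structure cut is a subgraph cut each of whose members is isomorphic to $H$, and an $H$-substructure cut is a subgraph cut each of whose members is isomorphic to a connected subgraph of $H$. $\kappa(G;H)$ (resp. $\kappa^s(G;H)$) is the minimum cardinality of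 an $H$-structure cut (resp. $H$-substructure cut) of $G$. *)

theory Defs
  imports "Graph_Theory.Graph_Theory" "HOL-Library.Extended_Nat"
begin

text \<open>
  A finite simple undirected graph is a \<^locale>\<open>pair_graph\<close>: finitely many vertices, no loops, and an
  edge is represented by its two opposite arcs. The bit string \<open>a_n \<dots> a_1\<close> is the list
  \<open>[a_n, \<dots>, a_1]\<close>, so a dimension is added by consing.
\<close>

fun AQ :: "nat \<Rightarrow> bool list pair_pre_digraph" where
  "AQ 0 = \<lparr>pverts = {[]}, parcs = {}\<rparr>" \<comment> \<open>not used: augmented cubes start at dimension 1\<close>
| "AQ (Suc 0) = \<lparr>pverts = {[False], [True]},
     parcs = {([False], [True]), ([True], [False])}\<rparr>"
| "AQ (Suc (Suc n)) = (let G = AQ (Suc n) in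
     \<lparr>pverts = {a # u |a u. u \<in> pverts G},
      parcs = {(a # u, a # v) |a u v. (u, v) \<in> parcs G}
        \<union> {(a # u, (\<not> a) # u) |a u. u \<in> pverts G}
        \<union> {(a # u, (\<not> a) # map Not u) |a u. u \<in> pverts G}\<rparr>)"

definition star :: "nat \<Rightarrow> nat pair_pre_digraph" where
  "star m = \<lparr>pverts = {0..m}, parcs = {0} \<times> {1..m} \<union> {1..m} \<times> {0}\<rparr>"

definition undirected_subgraph :: "'a pair_pre_digraph \<Rightarrow> 'a pair_pre_digraph \<Rightarrow> bool" where
  "undirected_subgraph K G \<longleftrightarrow> pair_graph K \<and> subgraph (with_proj K) (with_proj G)"

definition covered_verts :: "'a pair_pre_digraph set \<Rightarrow> 'a set" where
  "covered_verts F = (\<Union>K\<in>F. pverts K)"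

text \<open>
  The constant \<^const>\<open>connected\<close> is false for the graph without vertices. That graph is neither
  disconnected nor a single vertex, so a set of subgraphs covering all vertices is not a cut.
\<close>

definition subgraph_cut :: "'a pair_pre_digraph \<Rightarrow> 'a pair_pre_digraph set \<Rightarrow> bool" where
  "subgraph_cut G F \<longleftrightarrow> (\<forall>K\<in>F. undirected_subgraph K G) \<and>
     (let R = with_proj G \<restriction> (pverts G - covered_verts F)
      in verts R \<noteq> {} \<and> \<not> connected R \<or> card (verts R) = 1)"

definition structure_cut ::
  "'a pair_pre_digraph \<Rightarrow> 'b pair_pre_digraph \<Rightarrow> 'a pair_pre_digraph set \<Rightarrow> bool" where
  "structure_cut G H F \<longleftrightarrow> subgraph_cut G F \<and> (\<forall>K\<in>F. digraph_iso (with_proj K) (with_proj H))"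

definition substructure_cut ::
  "'a pair_pre_digraph \<Rightarrow> 'b pair_pre_digraph \<Rightarrow> 'a pair_pre_digraph set \<Rightarrow> bool" where
  "substructure_cut G H F \<longleftrightarrow> subgraph_cut G F \<and>
     (\<forall>K\<in>F. \<exists>H'. undirected_subgraph H' H \<and> connected (with_proj H') \<and>
        digraph_iso (with_proj K) (with_proj H'))"

text \<open>
  The minima are taken in \<^typ>\<open>enat\<close>, so that they are \<open>\<infinity>\<close> if there is no cut at all. For a finite
  graph every cut is a finite set (\<open>finite_subgraph_cut\<close> below), so \<^const>\<open>card\<close> is the true cardinality.
\<close>

definition structure_connectivity ::
  "'a pair_pre_digraph \<Rightarrow> 'b pair_pre_digraph \<Rightarrow> enat" (\<open>\<kappa>'(_;_')\<close>) where
  "\<kappa>(G;H) = (INF F\<in>{F. structure_cut G H F}. enat (card F))"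

definition substructure_connectivity ::
  "'a pair_pre_digraph \<Rightarrow> 'b pair_pre_digraph \<Rightarrow> enat" (\<open>\<kappa>\<^sup>s'(_;_')\<close>) where
  "\<kappa>\<^sup>s(G;H) = (INF F\<in>{F. substructure_cut G H F}. enat (card F))"

lemma finite_subgraph_cut:
  assumes "pair_graph G" "subgraph_cut G F"
  shows "finite F"
proof -
  interpret pair_graph G by fact
  have "finite ((\<lambda>(V, A). \<lparr>pverts = V, parcs = A\<rparr>) ` (Pow (pverts G) \<times> Pow (parcs G)))"
    using pair_finite_verts pair_finite_arcs by blast
  moreover have "F \<subseteq> (\<lambda>(V, A). \<lparr>pverts = V, parcs = A\<rparr>) ` (Pow (pverts G) \<times> Pow (parcs G))"
  proof
    fix K :: "'a pair_pre_digraph" assume "K \<in> F"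
    with assms(2) have "pverts K \<subseteq> pverts G" "parcs K \<subseteq> parcs G"
      by (auto simp: subgraph_cut_def undirected_subgraph_def subgraph_def)
    moreover have "K = \<lparr>pverts = pverts K, parcs = parcs K\<rparr>" by simp
    ultimately show "K \<in> (\<lambda>(V, A). \<lparr>pverts = V, parcs = A\<rparr>) ` (Pow (pverts G) \<times> Pow (parcs G))"
      by (intro image_eqI[where x = "(pverts K, parcs K)"]) auto
  qed
  ultimately show ?thesis by (rule finite_subset[rotated])
qed

lemma star_complete_bipartite: "K\<^bsub>1,m\<^esub> (with_proj (star m))"
  unfolding complete_bipartite_digraph_pair_def
proof (intro conjI exI)
  show "pverts (star m) = {0} \<union> {1..m}" by (auto simp: star_def)
qed (auto simp: star_def)

lemma pverts_AQ: "pverts (AQ n) = {u. length u = n}"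
proof (induction n rule: AQ.induct)
  case (3 n)
  then show ?case by (auto simp: Let_def length_Suc_conv)
qed (auto simp: length_Suc_conv)

text \<open>The adjacency by flipping a single bit, or all bits from some position down to bit 1.\<close>

lemma parcs_AQ:
  "(u, v) \<in> parcs (AQ n) \<longleftrightarrow> length u = n \<and>
     (\<exists>i<n. v = u[i := \<not> u ! i] \<or> v = take i u @ map Not (drop i u))"
proof (induction n arbitrary: u v rule: AQ.induct)
  case 2
  then show ?case by (auto simp: length_Suc_conv)
next
  case (3 n)
  show ?case
  proof (cases u)
    case (Cons a w)
    have "(u, v) \<in> parcs (AQ (Suc (Suc n))) \<longleftrightarrow>
        (\<exists>w'. v = a # w' \<and> (w, w') \<in> parcs (AQ (Suc n))) \<or>
        length w = Suc n \<and> (v = (\<not> a) # w \<or> v = (\<not> a) # map Not w)"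
      using Cons by (auto simp: Let_def pverts_AQ)
    also have "\<dots> \<longleftrightarrow> length u = Suc (Suc n) \<and> (\<exists>i<Suc (Suc n).
        v = u[i := \<not> u ! i] \<or> v = take i u @ map Not (drop i u))"
      unfolding 3 Ex_less_Suc2 using Cons by auto
    finally show ?thesis .
  qed (auto simp: Let_def)
qed auto

lemma pair_graph_AQ: "pair_graph (AQ n)"
proof -
  have wf: "fst e \<in> pverts (AQ n) \<and> snd e \<in> pverts (AQ n) \<and> fst e \<noteq> snd e"
    if "e \<in> parcs (AQ n)" for e
    using that
  proof (induction n arbitrary: e rule: AQ.induct)
    case (3 n)
    then show ?case by (fastforce simp: Let_def pverts_AQ)
  qed auto
  have fin: "finite (pverts (AQ n))"
    using finite_lists_length_eq[of "UNIV :: bool set" n] by (simp add: pverts_AQ)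
  have "parcs (AQ n) \<subseteq> pverts (AQ n) \<times> pverts (AQ n)"
    using wf by force
  with fin have "finite (parcs (AQ n))"
    by (meson finite_SigmaI finite_subset)
  moreover have sym: "(v, u) \<in> parcs (AQ n)" if "(u, v) \<in> parcs (AQ n)" for u v
    using that
  proof (induction n arbitrary: u v rule: AQ.induct)
    case (3 n)
    have "map Not (map Not w) = w" for w by (induction w) auto
    with 3 show ?case by (auto simp: Let_def pverts_AQ)
  qed auto
  ultimately show ?thesis
    using wf fin by unfold_locales (auto simp: symmetric_def intro: symI)
qed

end

(* Lower bound: fixing bit 1 splits AQ_n into two copies of the hypercube Q_{n-1}. A star centred
   at c lies in c and its neighbours; these form a hypercube star in the copy of c and, in the other
   copy, a geodesic between two antipodal vertices (a chain). A vertex which is not the centre has at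
   most two hypercube neighbours in any star or chain. Induction on N shows that Q_N stays connected
   after deleting parts of stars, chains and points of total weight at most N - 1, where stars and
   chains weigh 2, points weigh 1, and centres are deleted. Splitting Q_N along its first coordinate,
   a star or chain lies in one half, apart from a single point of the other half. If both halves
   contain such an object, both lose weight and are connected by induction. Otherwise one half only
   loses single points, so it is connected, and every vertex of the other half is adjacent to it or
   has a neighbour that is.

   Upper bound: let f_i be the neighbour of a vertex z obtained by flipping all bits from some list
   position i on, and e_i the one obtained by flipping only position i. The star centred at f_i can
   cover f_{i-1}, f_i, f_{i+1}, e_{i-1}, e_i, so the centres f_1, f_3, f_5, ... isolate z. *)

theory Submission
  imports Defs
begin

subsection \<open>Deleting stars and chains from a hypercube\<close>

primrec nbrs :: "bool list \<Rightarrow> bool list set" where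
  "nbrs [] = {}"
| "nbrs (a # u) = insert ((\<not> a) # u) (Cons a ` nbrs u)"

text \<open>The neighbours in an augmented cube across bit 1, with that bit dropped.\<close>

primrec chain :: "bool list \<Rightarrow> bool list set" where
  "chain [] = {[]}"
| "chain (a # u) = insert ((\<not> a) # map Not u) (Cons a ` chain u)"

abbreviation nball :: "bool list \<Rightarrow> bool list set" where
  "nball u \<equiv> insert u (nbrs u)"

definition cube_arcs :: "bool list rel" where
  "cube_arcs = {(u, v). v \<in> nbrs u}"

section \<open>Counting in hypercube neighbourhoods and chains\<close>

lemma length_nbrs: "v \<in> nbrs u \<Longrightarrow> length v = length u"
  by (induction u arbitrary: v) auto

lemma nbrs_sym: "v \<in> nbrs u \<Longrightarrow> u \<in> nbrs v"
  by (induction u arbitrary: v) auto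

lemma not_in_nbrs_self: "u \<notin> nbrs u"
  by (induction u) auto

lemma finite_nbrs [simp]: "finite (nbrs u)"
  by (induction u) auto

lemma finite_chain [simp]: "finite (chain u)"
  by (induction u) auto

lemma card_nbrs: "card (nbrs u) = length u"
  by (induction u) (auto simp: card_insert_if card_image)

text \<open>One vertex for each starting position of the flipped suffix, the empty suffix
  included.\<close>

lemma card_chain_le: "card (chain u) \<le> Suc (length u)"
proof (induction u)
  case (Cons a u)
  have "card (chain (a # u)) \<le> Suc (card (Cons a ` chain u))"
    by (simp add: card_insert_le_m1)
  with Cons show ?case by (simp add: card_image)
qed simp

lemma self_in_chain: "u \<in> chain u"
  by (induction u) auto

lemma map_Not_in_chain: "map Not u \<in> chain u"
  by (cases u) auto

text \<open>Distinct hypercube vertices have at most two common neighbours, and none if adjacent,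
  when only \<open>s\<close> itself counts. In the induction, equal first bits keep the intersection
  in one half; different first bits leave two candidates.\<close>

lemma card_nbrs_Int_nball_le:
  assumes "v \<noteq> s"
  shows "card (nbrs v \<inter> nball s) \<le> 2"
  using assms
proof (induction s arbitrary: v)
  case Nil
  then have "nbrs v \<inter> nball [] = {}" by (cases v) auto
  then show ?case by simp
next
  case (Cons a u)
  show ?case
  proof (cases v)
    case (Cons x y)
    show ?thesis
    proof (cases "x = a")
      case True
      with \<open>v \<noteq> a # u\<close> Cons have "y \<noteq> u" by simp
      moreover from this have "nbrs v \<inter> nball (a # u) = Cons a ` (nbrs y \<inter> nball u)"
        using Cons True by auto
      ultimately show ?thesis
        using Cons.IH[of y] by (simp add: card_image)
    next
      case False
      then have "nbrs v \<inter> nball (a # u) \<subseteq> {a # y, (\<not> a) # u}"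
        using Cons by auto
      from card_mono[OF _ this] show ?thesis by (auto simp: card_insert_if split: if_splits)
    qed
  qed simp
qed

text \<open>The complement of \<open>c\<close> is an end of the geodesic, so only the next vertex of
  the chain can be adjacent to it.\<close>

lemma card_nbrs_Int_chain_end: "card (nbrs (map Not c) \<inter> chain c) \<le> 1"
proof (cases c)
  case (Cons a u)
  then have "nbrs (map Not c) \<inter> chain c \<subseteq> {a # map Not u}"
    using not_in_nbrs_self by auto
  from card_mono[OF _ this] show ?thesis by simp
qed simp

text \<open>Neighbours of \<open>v\<close> are pairwise at distance two, and a geodesic has no three
  such vertices.\<close>

lemma card_nbrs_Int_chain_le: "card (nbrs v \<inter> chain c) \<le> 2"
proof (induction c arbitrary: v)
  case Nil
  have "nbrs v \<inter> chain [] = {}" by (cases v) auto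
  then show ?case by simp
next
  case (Cons a u)
  show ?case
  proof (cases v)
    case (Cons x y)
    consider "x = a" "y = map Not u" | "x = a" "y \<noteq> map Not u" | "x \<noteq> a" by blast
    then show ?thesis
    proof cases
      \<comment> \<open>Here \<open>(\<not> a) # y\<close> joins the intersection; the sharper bound
        at the end of \<open>chain u\<close> leaves room for it.\<close>
      case 1
      then have "nbrs v \<inter> chain (a # u) = insert ((\<not> a) # y) (Cons a ` (nbrs y \<inter> chain u))"
        using Cons by auto
      moreover have "card (nbrs y \<inter> chain u) \<le> 1"
        using card_nbrs_Int_chain_end 1 by simp
      ultimately show ?thesis
        by (simp add: card_insert_if card_image)
    next
      case 2
      then have "nbrs v \<inter> chain (a # u) = Cons a ` (nbrs y \<inter> chain u)"
        using Cons by auto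
      then show ?thesis
        using Cons.IH[of y] by (simp add: card_image)
    next
      case 3
      then have "nbrs v \<inter> chain (a # u) \<subseteq> {a # y, (\<not> a) # map Not u}"
        using Cons by auto
      from card_mono[OF _ this] show ?thesis by (auto simp: card_insert_if split: if_splits)
    qed
  qed simp
qed

lemma card_halves_le:
  assumes "finite A"
  shows "card {w. b # w \<in> A} + card {w. (\<not> b) # w \<in> A} \<le> card A"
proof -
  have fin: "finite {w. b # w \<in> A}" for b
    using finite_vimageI[OF assms, of "Cons b"] by (simp add: vimage_def)
  have "card {w. b # w \<in> A} + card {w. (\<not> b) # w \<in> A}
      = card (Cons b ` {w. b # w \<in> A} \<union> Cons (\<not> b) ` {w. (\<not> b) # w \<in> A})"
    using fin by (subst card_Un_disjoint) (auto simp: card_image)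
  also have "\<dots> \<le> card A"
    using assms by (intro card_mono) auto
  finally show ?thesis .
qed

lemma finite_half: "finite A \<Longrightarrow> finite {w. b # w \<in> A}"
  using finite_vimageI[of A "Cons b"] by (simp add: vimage_def)

text \<open>Carries walks from a half into the whole hypercube, and from a hypercube into the
  augmented cube.\<close>

lemma rtrancl_on_map:
  assumes "(u, v) \<in> rtrancl_on V r" "f ` V \<subseteq> W"
    and "\<And>x y. x \<in> V \<Longrightarrow> y \<in> V \<Longrightarrow> (x, y) \<in> r \<Longrightarrow> (f x, f y) \<in> s"
  shows "(f u, f v) \<in> rtrancl_on W s"
  using assms(1)
proof induction
  case base
  then show ?case using assms(2) by auto
next
  case (step y z)
  then show ?case
    using assms(2,3) converse_rtrancl_on_into_rtrancl_on[of "f y" "f z" s "f v" W] by auto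
qed

lemma rtrancl_on_sym:
  assumes "(u, v) \<in> rtrancl_on V r" "sym r"
  shows "(v, u) \<in> rtrancl_on V r"
  using rtrancl_on_converseI[OF assms(1)] assms(2) by (simp add: sym_conv_converse_eq)

lemma sym_cube_arcs: "sym cube_arcs"
  by (auto simp: cube_arcs_def sym_def dest: nbrs_sym)

section \<open>Families of deleted stars, chains and points, and their weights\<close>

definition blocked :: "bool list set \<Rightarrow> bool list set \<Rightarrow> bool list set \<Rightarrow> bool list set" where
  "blocked S C P = (\<Union>s\<in>S. nball s) \<union> (\<Union>c\<in>C. chain c) \<union> P"

lemma finite_blocked: "finite S \<Longrightarrow> finite C \<Longrightarrow> finite P \<Longrightarrow> finite (blocked S C P)"
  by (simp add: blocked_def)

text \<open>A star or chain meets the opposite half in one vertex: below its centre for a star, the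
  complementary end for a chain. In that half it therefore counts as a point.\<close>

lemma Cons_in_blockedD:
  assumes "b # w \<in> blocked S C P" "[] \<notin> S" "[] \<notin> C"
  shows "w \<in> blocked {w. b # w \<in> S} {w. b # w \<in> C}
    ({w. b # w \<in> P} \<union> {w. (\<not> b) # w \<in> S} \<union> map Not ` {w. (\<not> b) # w \<in> C})"
proof -
  consider s where "s \<in> S" "b # w \<in> nball s" | c where "c \<in> C" "b # w \<in> chain c" | "b # w \<in> P"
    using assms(1) by (auto simp: blocked_def)
  then show ?thesis
  proof cases
    case 1
    with assms(2) obtain a s' where "s = a # s'" by (cases s) auto
    with 1 show ?thesis by (cases "a = b") (auto simp: blocked_def)
  next
    case 2
    with assms(3) obtain a c' where "c = a # c'" by (cases c) auto
    with 2 show ?thesis by (cases "a = b") (auto simp: blocked_def)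
  next
    case 3
    then show ?thesis by (simp add: blocked_def)
  qed
qed

lemma card_blocked_le:
  assumes "finite S" "finite C" "finite P" "\<forall>u\<in>S \<union> C. length u = N"
  shows "card (blocked S C P) \<le> (card S + card C) * Suc N + card P"
proof -
  have "card (\<Union>s\<in>S. nball s) \<le> (\<Sum>s\<in>S. Suc N)"
    using assms by (intro order.trans[OF card_UN_le] sum_mono)
      (auto simp: card_insert_if card_nbrs not_in_nbrs_self)
  moreover have "card (\<Union>c\<in>C. chain c) \<le> (\<Sum>c\<in>C. Suc N)"
    using assms card_chain_le by (intro order.trans[OF card_UN_le] sum_mono) force+
  moreover have "card (blocked S C P) \<le> card (\<Union>s\<in>S. nball s) + card (\<Union>c\<in>C. chain c) + card P"
    unfolding blocked_def by (meson card_Un_le add_le_mono1 order_trans)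
  ultimately show ?thesis by (simp add: algebra_simps)
qed

text \<open>This is the reason for the weights 2, 2 and 1.\<close>

lemma card_nbrs_Int_blocked_le:
  assumes "finite S" "finite C" "finite P" "v \<notin> S"
  shows "card (nbrs v \<inter> blocked S C P) \<le> 2 * card S + 2 * card C + card P"
proof -
  have "card (\<Union>s\<in>S. nbrs v \<inter> nball s) \<le> (\<Sum>s\<in>S. 2)"
    using assms by (intro order.trans[OF card_UN_le] sum_mono card_nbrs_Int_nball_le) auto
  moreover have "card (\<Union>c\<in>C. nbrs v \<inter> chain c) \<le> (\<Sum>c\<in>C. 2)"
    using assms card_nbrs_Int_chain_le by (intro order.trans[OF card_UN_le] sum_mono) auto
  moreover have "card (nbrs v \<inter> P) \<le> card P"
    using assms by (intro card_mono) auto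
  moreover have "nbrs v \<inter> blocked S C P
      = (\<Union>s\<in>S. nbrs v \<inter> nball s) \<union> (\<Union>c\<in>C. nbrs v \<inter> chain c) \<union> nbrs v \<inter> P"
    by (auto simp: blocked_def)
  moreover have "card ((\<Union>s\<in>S. nbrs v \<inter> nball s) \<union> (\<Union>c\<in>C. nbrs v \<inter> chain c) \<union> nbrs v \<inter> P)
      \<le> card (\<Union>s\<in>S. nbrs v \<inter> nball s) + card (\<Union>c\<in>C. nbrs v \<inter> chain c) + card (nbrs v \<inter> P)"
    by (meson card_Un_le add_le_mono1 order_trans)
  ultimately show ?thesis by simp
qed

text \<open>A chain has only one neighbour of its end point, which makes the inequality strict.\<close>

lemma exists_nbr_not_blocked:
  assumes "finite S" "finite C" "finite P" "v \<notin> S" "c \<in> C" "v = map Not c"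
    and "2 * card S + 2 * card C + card P \<le> length v"
  obtains v' where "v' \<in> nbrs v" "v' \<notin> blocked S C P"
proof -
  have eq: "nbrs v \<inter> blocked S C P = nbrs v \<inter> blocked S (C - {c}) P \<union> nbrs v \<inter> chain c"
    using assms(5) by (auto simp: blocked_def)
  have "card (nbrs v \<inter> blocked S C P)
      \<le> card (nbrs v \<inter> blocked S (C - {c}) P) + card (nbrs v \<inter> chain c)"
    unfolding eq by (rule card_Un_le)
  also have "\<dots> \<le> 2 * card S + 2 * card (C - {c}) + card P + 1"
    using assms card_nbrs_Int_chain_end
    by (intro add_mono card_nbrs_Int_blocked_le) auto
  also have "\<dots> < card (nbrs v)"
  proof -
    have "card C = Suc (card (C - {c}))"
      using assms(2,5) by (rule card.remove)
    then show ?thesis using assms(7) by (simp add: card_nbrs)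
  qed
  finally have "nbrs v \<inter> blocked S C P \<noteq> nbrs v" by auto
  with that show ?thesis by blast
qed

text \<open>Ensures that some edge between the two halves survives the deletion.\<close>

lemma Suc_mult_less_two_power: "N * Suc N < 2 * 2 ^ N"
proof (induction N)
  case (Suc N)
  have "Suc N \<le> 2 ^ N" by (rule Suc_leI) simp
  with Suc show ?case by simp
qed simp

lemma card_bool_lists: "card {u :: bool list. length u = N} = 2 ^ N"
  using card_lists_length_eq[of "UNIV :: bool set" N] by simp

text \<open>
  The centres \<open>S\<close> must be deleted: a centre that remains would have all its neighbours in its star.
\<close>

lemma cube_minus_blocked_connected:
  assumes "finite S" "finite C" "finite P" "\<forall>u\<in>S \<union> C. length u = N"
    and "S \<subseteq> X" "X \<subseteq> blocked S C P" "2 * card S + 2 * card C + card P \<le> N - 1"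
    and "length u = N" "length v = N" "u \<notin> X" "v \<notin> X"
  shows "(u, v) \<in> rtrancl_on ({u. length u = N} - X) cube_arcs"
  using assms
proof (induction N arbitrary: S C P X u v)
  case 0
  then show ?case by auto
next
  case (Suc N)
  note fin = \<open>finite S\<close> \<open>finite C\<close> \<open>finite P\<close>
  define half where "half A b = {w. b # w \<in> A}" for A and b :: bool
  define pts where
    "pts b = half P b \<union> half S (\<not> b) \<union> map Not ` half C (\<not> b)" for b
  define V where "V = {u :: bool list. length u = Suc N} - X"
  have fin_half: "finite (half S b)" "finite (half C b)" "finite (half P b)" for b
    using fin by (auto simp: half_def intro: finite_half)
  then have fin_pts: "finite (pts b)" for b by (simp add: pts_def)
  have card_half: "card (half S b) + card (half S (\<not> b)) \<le> card S"
    "card (half C b) + card (half C (\<not> b)) \<le> card C"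
    "card (half P b) + card (half P (\<not> b)) \<le> card P" for b
    using fin card_halves_le by (auto simp: half_def)
  have card_pts: "card (pts b) \<le> card (half P b) + card (half S (\<not> b)) + card (half C (\<not> b))" for b
  proof -
    have "card (pts b) \<le> card (half P b) + card (half S (\<not> b)) + card (map Not ` half C (\<not> b))"
      unfolding pts_def by (meson card_Un_le add_le_mono1 order_trans)
    with card_image_le[OF fin_half(2), of "map Not" "\<not> b"] show ?thesis by linarith
  qed
  have len: "\<forall>w\<in>half S b \<union> half C b. length w = N" for b
  proof
    fix w assume "w \<in> half S b \<union> half C b"
    then have "b # w \<in> S \<union> C" by (auto simp: half_def)
    with Suc.prems(4) have "length (b # w) = Suc N" by blast
    then show "length w = N" by simp
  qed
  have blocked_half: "half X b \<subseteq> blocked (half S b) (half C b) (pts b)" for b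
  proof
    fix w assume "w \<in> half X b"
    then have "b # w \<in> blocked S C P" using Suc.prems(6) by (auto simp: half_def)
    from Cons_in_blockedD[OF this] show "w \<in> blocked (half S b) (half C b) (pts b)"
      using Suc.prems(4) by (force simp: half_def pts_def)
  qed
  have W: "2 * card S + 2 * card C + card P \<le> N" using Suc.prems(7) by simp
  \<comment> \<open>The weight that half \<open>b\<close> is spared: a star or chain of the other
    half drops from 2 to 1, a point from 1 to 0.\<close>
  define loss where
    "loss b = card (half S (\<not> b)) + card (half C (\<not> b)) + card (half P (\<not> b))" for b
  have linked: "(b # x, b # y) \<in> rtrancl_on V cube_arcs"
    if "loss b \<noteq> 0 \<or> loss (\<not> b) = 0" "b # x \<in> V" "b # y \<in> V" for b x y
  proof -
    \<comment> \<open>If \<open>loss (\<not> b) = 0\<close>, half \<open>b\<close> keeps only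
      points, one for each star or chain of the other half. These are at most
      \<open>N div 2\<close>, hence at most \<open>N - 1\<close> in truncated subtraction, even for
      \<open>N = 0\<close>.\<close>
    have "2 * card (half S b) + 2 * card (half C b) + card (pts b) \<le> N - 1"
      using that(1) W card_half[of b] card_pts[of b] unfolding loss_def not_not by linarith
    moreover have "half S b \<subseteq> half X b" using Suc.prems(5) by (auto simp: half_def)
    moreover have "length x = N" "length y = N" "x \<notin> half X b" "y \<notin> half X b"
      using that(2,3) by (auto simp: V_def half_def)
    ultimately have "(x, y) \<in> rtrancl_on ({u. length u = N} - half X b) cube_arcs"
      using Suc.IH[OF fin_half(1,2) fin_pts len _ blocked_half] by blast
    then show ?thesis
      by (rule rtrancl_on_map) (auto simp: V_def half_def cube_arcs_def)
  qed
  have arc: "(b # w, (\<not> b) # w) \<in> rtrancl_on V cube_arcs" if "b # w \<in> V" "(\<not> b) # w \<in> V" for b w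
    using that by (auto simp: cube_arcs_def intro!: rtrancl_on_into_rtrancl_on[OF rtrancl_on_refl])
  \<comment> \<open>Both cases reduce to this: one half is linked within \<open>V\<close>, and every
    remaining vertex of the other half reaches it.\<close>
  have "\<exists>b. (\<forall>x y. b # x \<in> V \<longrightarrow> b # y \<in> V \<longrightarrow> (b # x, b # y) \<in> rtrancl_on V cube_arcs) \<and>
      (\<forall>x. (\<not> b) # x \<in> V \<longrightarrow> (\<exists>y. b # y \<in> V \<and> ((\<not> b) # x, b # y) \<in> rtrancl_on V cube_arcs))"
  proof (cases "loss True \<noteq> 0 \<and> loss False \<noteq> 0")
    case True
    \<comment> \<open>Projects the deleted vertices of both halves to \<open>N\<close> coordinates;
      any vertex outside \<open>B\<close> gives a surviving edge between the halves.\<close>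
    define B where "B = blocked (half S True \<union> half S False) (half C True \<union> half C False)
      (half P True \<union> half P False)"
    have half_B: "half X b \<subseteq> B" for b
    proof -
      \<comment> \<open>Points inherited from the other half already lie in their own star or chain,
        so they do not enlarge the count.\<close>
      have "half S (\<not> b) \<subseteq> B" "map Not ` half C (\<not> b) \<subseteq> B"
        using map_Not_in_chain by (cases b; force simp: B_def blocked_def)+
      then have "pts b \<subseteq> half P b \<union> B" by (auto simp: pts_def)
      then have "blocked (half S b) (half C b) (pts b) \<subseteq> B"
        by (cases b) (auto simp: B_def blocked_def)
      with blocked_half show ?thesis by blast
    qed
    have "card B \<le> (card (half S True \<union> half S False) + card (half C True \<union> half C False)) * Suc N
        + card (half P True \<union> half P False)"
      unfolding B_def using fin_half len[of True] len[of False] by (intro card_blocked_le) auto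
    also have "\<dots> \<le> (card S + card C) * Suc N + card P"
    proof (intro add_mono mult_le_mono1)
      show "card (half S True \<union> half S False) \<le> card S"
        using card_Un_le[of "half S True" "half S False"] card_half(1)[of True] by simp
      show "card (half C True \<union> half C False) \<le> card C"
        using card_Un_le[of "half C True" "half C False"] card_half(2)[of True] by simp
      show "card (half P True \<union> half P False) \<le> card P"
        using card_Un_le[of "half P True" "half P False"] card_half(3)[of True] by simp
    qed
    also have "\<dots> < 2 ^ N"
    proof (cases N)
      case (Suc k)
      \<comment> \<open>Doubling turns the numbers of stars and chains into weights;
        \<open>2 \<le> Suc N\<close> absorbs the points.\<close>
      have "2 * ((card S + card C) * Suc N + card P) \<le> (2 * card S + 2 * card C + card P) * Suc N"
        using Suc by (simp add: algebra_simps)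
      also have "\<dots> \<le> N * Suc N" using W by (rule mult_le_mono1)
      also have "\<dots> < 2 * 2 ^ N" by (rule Suc_mult_less_two_power)
      finally show ?thesis by simp
    qed (use W in simp)
    finally have "\<not> {u. length u = N} \<subseteq> B"
    proof -
      assume "card B < 2 ^ N"
      moreover have "finite B" unfolding B_def using fin_half by (intro finite_blocked) auto
      ultimately show ?thesis
        using card_mono[of B "{u. length u = N}"] by (auto simp: card_bool_lists)
    qed
    then obtain w where w: "length w = N" "w \<notin> B" by blast
    then have wV: "b # w \<in> V" for b using half_B[of b] by (auto simp: V_def half_def)
    have "(False # x, True # w) \<in> rtrancl_on V cube_arcs" if "False # x \<in> V" for x
      using rtrancl_on_trans[OF linked[of False x w] arc[of False w]] True that wV by simp
    then have "\<exists>y. True # y \<in> V \<and> (False # x, True # y) \<in> rtrancl_on V cube_arcs"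
      if "False # x \<in> V" for x
      using that wV by blast
    then show ?thesis using True linked[of True] by (intro exI[of _ True]) simp
  next
    case False
    then obtain b where b: "loss (\<not> b) = 0" by (metis (full_types))
    then have empty: "half S b = {}" "half C b = {}" "half P b = {}"
      using fin_half by (auto simp: loss_def)
    have "\<exists>y. b # y \<in> V \<and> ((\<not> b) # x, b # y) \<in> rtrancl_on V cube_arcs"
      if x: "(\<not> b) # x \<in> V" for x
    proof (cases "b # x \<in> V")
      case True
      with x arc[of "\<not> b" x] show ?thesis by auto
    next
      case False
      have length_x: "length x = N" using x by (simp add: V_def)
      with False have "x \<in> half X b" by (simp add: V_def half_def)
      \<comment> \<open>Half \<open>b\<close> has no objects of its own, so \<open>b # x\<close> was
        removed by a centre or a chain end opposite. Centres are deleted but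
        \<open>(\<not> b) # x\<close> remains, which leaves the chain end.\<close>
      with blocked_half[of b] empty have "x \<in> half S (\<not> b) \<union> map Not ` half C (\<not> b)"
        by (auto simp: blocked_def pts_def)
      moreover have x_notin: "x \<notin> half S (\<not> b)"
        using x Suc.prems(5) by (auto simp: V_def half_def)
      ultimately obtain c where c: "c \<in> half C (\<not> b)" "x = map Not c" by blast
      have "2 * card (half S (\<not> b)) + 2 * card (half C (\<not> b)) + card (half P (\<not> b)) \<le> length x"
        using W card_half[of b] length_x by linarith
      from exists_nbr_not_blocked[OF fin_half x_notin c this] obtain x'
        where x': "x' \<in> nbrs x" "x' \<notin> blocked (half S (\<not> b)) (half C (\<not> b)) (half P (\<not> b))" .
      have length_x': "length x' = N" using x'(1) length_x by (simp add: length_nbrs)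
      have "pts (\<not> b) = half P (\<not> b)" using empty by (simp add: pts_def)
      with x'(2) blocked_half[of "\<not> b"] have "x' \<notin> half X (\<not> b)" by auto
      with length_x' have x'V: "(\<not> b) # x' \<in> V" by (simp add: V_def half_def)
      \<comment> \<open>Every point of half \<open>b\<close> comes from a centre or chain end that
        is blocked in the other half too, so \<open>b # x'\<close> also survives.\<close>
      have "x' \<notin> pts b"
        using x'(2) empty map_Not_in_chain by (auto simp: pts_def blocked_def)
      then have "x' \<notin> half X b"
        using blocked_half[of b] empty by (auto simp: blocked_def)
      with length_x' have bx'V: "b # x' \<in> V" by (simp add: V_def half_def)
      have "((\<not> b) # x, (\<not> b) # x') \<in> rtrancl_on V cube_arcs"
        using x x'V x'(1)
        by (auto simp: cube_arcs_def intro!: rtrancl_on_into_rtrancl_on[OF rtrancl_on_refl])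
      moreover have "((\<not> b) # x', b # x') \<in> rtrancl_on V cube_arcs"
        using arc[of "\<not> b" x'] x'V bx'V by simp
      ultimately have "((\<not> b) # x, b # x') \<in> rtrancl_on V cube_arcs" by (rule rtrancl_on_trans)
      with bx'V show ?thesis by blast
    qed
    with linked[of b] b show ?thesis by (intro exI[of _ b]) blast
  qed
  then obtain b where
    b1: "\<And>x y. b # x \<in> V \<Longrightarrow> b # y \<in> V \<Longrightarrow> (b # x, b # y) \<in> rtrancl_on V cube_arcs" and
    b2: "\<And>x. (\<not> b) # x \<in> V \<Longrightarrow> \<exists>y. b # y \<in> V \<and> ((\<not> b) # x, b # y) \<in> rtrancl_on V cube_arcs"
    by blast
  have reach: "\<exists>y. b # y \<in> V \<and> (z, b # y) \<in> rtrancl_on V cube_arcs" if z: "z \<in> V" for z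
  proof -
    obtain a x where ax: "z = a # x" using z by (cases z) (auto simp: V_def)
    show ?thesis
    proof (cases "a = b")
      case True
      with z ax show ?thesis by blast
    next
      case False
      then have "a = (\<not> b)" by blast
      with z ax b2 show ?thesis by blast
    qed
  qed
  have "u \<in> V" "v \<in> V" using Suc.prems by (auto simp: V_def)
  with reach obtain x y where x: "b # x \<in> V" "(u, b # x) \<in> rtrancl_on V cube_arcs"
    and y: "b # y \<in> V" "(v, b # y) \<in> rtrancl_on V cube_arcs" by meson
  have "(u, v) \<in> rtrancl_on V cube_arcs"
    using rtrancl_on_trans[OF x(2) rtrancl_on_trans[OF b1[OF x(1) y(1)]
      rtrancl_on_sym[OF y(2) sym_cube_arcs]]] .
  then show ?case by (simp add: V_def)
qed

subsection \<open>Stars in augmented cubes\<close>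

text \<open>Bit 1 is the last list entry. Suffix flips all change it and give the chain, in which
  \<open>w\<close> itself stands for flipping bit 1 alone; single flips elsewhere keep it.\<close>

lemma AQ_snoc_arcs:
  assumes "length w = N" "length w' = N"
  shows "(w @ [b], w' @ [b']) \<in> parcs (AQ (Suc N)) \<longleftrightarrow>
    (if b' = b then w' \<in> nbrs w else w' \<in> chain w)"
  using assms
proof (induction N arbitrary: w w')
  case 0
  then show ?case by auto
next
  case (Suc N)
  then obtain a u a' u' where eq: "w = a # u" "w' = a' # u'" "length u = N" "length u' = N"
    by (auto simp: length_Suc_conv)
  have "(w @ [b], w' @ [b']) \<in> parcs (AQ (Suc (Suc N))) \<longleftrightarrow>
      (a' = a \<and> (u @ [b], u' @ [b']) \<in> parcs (AQ (Suc N))) \<or>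
      (a' = (\<not> a) \<and> u' = u \<and> b' = b) \<or> (a' = (\<not> a) \<and> u' = map Not u \<and> b' = (\<not> b))"
    using eq by (auto simp: Let_def pverts_AQ)
  then show ?case
    using Suc.IH[of u u'] eq by auto
qed

section \<open>Connectedness of symmetric digraphs and subgraphs of stars\<close>

lemma arcs_ends_with_proj: "arcs_ends (with_proj G) = parcs G"
  by (auto simp: arcs_ends_def arc_to_ends_def)

lemma arcs_ends_induced:
  "arcs_ends (with_proj G \<restriction> V) = {(u, v). (u, v) \<in> parcs G \<and> u \<in> V \<and> v \<in> V}"
  by (force simp: arcs_ends_def arc_to_ends_def induce_subgraph_def)

lemma connected_iff_symmetric:
  assumes "sym (arcs_ends R)"
  shows "connected R \<longleftrightarrow>
    verts R \<noteq> {} \<and> (\<forall>u\<in>verts R. \<forall>v\<in>verts R. (u, v) \<in> rtrancl_on (verts R) (arcs_ends R))"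
proof -
  have "parcs (mk_symmetric R) = arcs_ends R \<union> (arcs_ends R)\<inverse>"
    by (auto simp: mk_symmetric_def arcs_ends_def arc_to_ends_def)
  also have "\<dots> = arcs_ends R" using assms by (auto dest: symD)
  finally show ?thesis
    by (simp add: connected_def strongly_connected_def reachable_def arcs_ends_with_proj
        mk_symmetric_def)
qed

lemma sym_parcs: "pair_graph G \<Longrightarrow> sym (parcs G)"
proof -
  assume "pair_graph G"
  then interpret pair_graph G .
  show ?thesis using sym_arcs by (simp add: symmetric_def arcs_ends_with_proj)
qed

lemma sym_arcs_ends_induced: "pair_graph G \<Longrightarrow> sym (arcs_ends (with_proj G \<restriction> V))"
  using sym_parcs[of G] by (auto simp: arcs_ends_induced sym_def)

lemma rtrancl_on_first_step:
  assumes "(u, v) \<in> rtrancl_on V r" "u \<noteq> v"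
  shows "\<exists>y\<in>V. (u, y) \<in> r"
  using assms by (induction rule: converse_rtrancl_on_induct) auto

text \<open>Leaves of a star are pairwise non-adjacent. So either 0 is present and is the hub, or
  connectedness leaves only one leaf.\<close>

lemma connected_star_subgraph_center:
  assumes "undirected_subgraph H (star m)" "connected (with_proj H)"
  shows "\<exists>h\<in>pverts H. \<forall>x\<in>pverts H. x \<noteq> h \<longrightarrow> (h, x) \<in> parcs H"
proof -
  have H: "pair_graph H" and arcs: "parcs H \<subseteq> parcs (star m)"
    using assms(1) by (auto simp: undirected_subgraph_def subgraph_def)
  interpret pair_graph H by (rule H)
  have sym: "sym (parcs H)" using H by (rule sym_parcs)
  have ne: "pverts H \<noteq> {}"
    and reach: "\<And>x y. x \<in> pverts H \<Longrightarrow> y \<in> pverts H \<Longrightarrow> (x, y) \<in> rtrancl_on (pverts H) (parcs H)"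
    using assms(2) sym by (auto simp: connected_iff_symmetric arcs_ends_with_proj)
  have step: "\<exists>z. (x, z) \<in> parcs H" if "x \<in> pverts H" "y \<in> pverts H" "x \<noteq> y" for x y
    using rtrancl_on_first_step[OF reach[OF that(1,2)] that(3)] by blast
  show ?thesis
  proof (cases "0 \<in> pverts H")
    case True
    have "(0, x) \<in> parcs H" if x: "x \<in> pverts H" "x \<noteq> 0" for x
    proof -
      obtain z where z: "(x, z) \<in> parcs H" using step[OF x(1) True x(2)] ..
      with arcs x(2) have "z = 0" by (auto simp: star_def)
      with z sym show ?thesis by (auto dest: symD)
    qed
    with True show ?thesis by blast
  next
    case False
    have "x = y" if "x \<in> pverts H" "y \<in> pverts H" for x y
    proof (rule ccontr)
      assume "x \<noteq> y"
      with step that obtain z where z: "(x, z) \<in> parcs H" by blast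
      then have "z \<in> pverts H" using in_arcsD2 by blast
      moreover have "x = 0 \<or> z = 0" using z arcs by (auto simp: star_def)
      ultimately show False using that(1) False by auto
    qed
    with ne show ?thesis by blast
  qed
qed

text \<open>The hub is pulled back along the isomorphism. The lower bound uses no other property of
  the members of a cut.\<close>

lemma star_substructure_center:
  assumes "undirected_subgraph K G" "undirected_subgraph H (star m)" "connected (with_proj H)"
    and "digraph_iso (with_proj K) (with_proj H)"
  shows "\<exists>c\<in>pverts K. \<forall>v\<in>pverts K. v \<noteq> c \<longrightarrow> (c, v) \<in> parcs G"
proof -
  have K: "pair_graph K" and sub: "parcs K \<subseteq> parcs G"
    using assms(1) by (auto simp: undirected_subgraph_def subgraph_def)
  interpret K: pair_graph K by (rule K)
  obtain f where f: "pre_digraph.digraph_isomorphism (with_proj K) f"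
    and H: "with_proj H = app_iso f (with_proj K)"
    using assms(4) by (auto simp: digraph_iso_def)
  define g where "g = iso_verts f"
  have inj: "inj_on g (pverts K)"
    using f by (simp add: pre_digraph.digraph_isomorphism_def g_def)
  \<comment> \<open>Comparing the fields of both sides of \<open>H\<close> forces the end maps of
    \<open>f\<close> to be the projections, so arcs are mapped by their end points.\<close>
  have pH: "pverts H = g ` pverts K" "parcs H = iso_arcs f ` parcs K"
    and tails: "iso_tail f = fst" "iso_head f = snd"
    using arg_cong[OF H, of verts] arg_cong[OF H, of arcs] arg_cong[OF H, of tail]
      arg_cong[OF H, of head] by (simp_all add: g_def)
  have ends: "iso_arcs f e = (g (fst e), g (snd e))" if "e \<in> parcs K" for e
    using f that tails by (simp add: pre_digraph.digraph_isomorphism_def g_def prod_eq_iff)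
  obtain c where c: "c \<in> pverts K" and
    hub: "\<And>v. v \<in> pverts K \<Longrightarrow> g v \<noteq> g c \<Longrightarrow> (g c, g v) \<in> parcs H"
    using connected_star_subgraph_center[OF assms(2,3)] unfolding pH(1) by blast
  have "(c, v) \<in> parcs K" if v: "v \<in> pverts K" "v \<noteq> c" for v
  proof -
    have "g v \<noteq> g c" using inj v c by (auto dest: inj_onD)
    with hub v(1) have "(g c, g v) \<in> iso_arcs f ` parcs K" unfolding pH(2) by blast
    then obtain e where e: "e \<in> parcs K" "iso_arcs f e = (g c, g v)" by force
    then have "g (fst e) = g c" "g (snd e) = g v" using ends by auto
    moreover have "fst e \<in> pverts K" "snd e \<in> pverts K"
      using e(1) K.wellformed by auto
    ultimately have "e = (c, v)" using inj c v(1) by (auto simp: prod_eq_iff dest: inj_onD)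
    with e(1) show ?thesis by simp
  qed
  with c sub show ?thesis by blast
qed

section \<open>The lower bound\<close>

lemma square_le_two_power: "4 \<le> N \<Longrightarrow> N * N \<le> 2 ^ N"
proof (induction N rule: dec_induct)
  case (step k)
  have "Suc k * Suc k \<le> 2 * (k * k)"
  proof -
    have "4 * k \<le> k * k" using step(1) by (rule mult_le_mono1)
    moreover have "Suc k * Suc k = k * k + 2 * k + 1" by simp
    ultimately show ?thesis using step(1) by linarith
  qed
  with step show ?case by simp
qed simp

text \<open>For fewer members, both hypercube copies stay connected and an edge
  \<open>w @ [True]\<close>, \<open>w @ [False]\<close> between them survives, so the remainder is
  connected with at least two vertices.\<close>

lemma half_dimension_le_card_cut:
  assumes cut: "subgraph_cut (AQ n) F"
    and hub: "\<forall>K\<in>F. \<exists>c\<in>pverts K. \<forall>v\<in>pverts K. v \<noteq> c \<longrightarrow> (c, v) \<in> parcs (AQ n)"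
    and "5 \<le> n"
  shows "n div 2 \<le> card F"
proof (rule ccontr)
  assume "\<not> n div 2 \<le> card F"
  obtain N where n: "n = Suc N" "4 \<le> N" using assms(3) by (cases n) auto
  with \<open>\<not> n div 2 \<le> card F\<close> have t: "2 * card F \<le> N - 1" by linarith
  have "finite F" using finite_subgraph_cut[OF pair_graph_AQ cut] .
  obtain c where c: "\<And>K. K \<in> F \<Longrightarrow> c K \<in> pverts K"
    "\<And>K v. K \<in> F \<Longrightarrow> v \<in> pverts K \<Longrightarrow> v \<noteq> c K \<Longrightarrow> (c K, v) \<in> parcs (AQ n)"
    using hub by metis
  have pverts: "v \<in> pverts K \<Longrightarrow> length v = n" if "K \<in> F" for K v
    using cut that by (auto simp: subgraph_cut_def undirected_subgraph_def subgraph_def pverts_AQ)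
  define S where "S b = {w. w @ [b] \<in> c ` F}" for b
  define X where "X b = {w. w @ [b] \<in> covered_verts F}" for b
  have img: "(\<lambda>w. w @ [b]) ` S b \<subseteq> c ` F" for b by (auto simp: S_def)
  have finS: "finite (S b)" for b
    using finite_subset[OF img] \<open>finite F\<close> by (auto dest!: finite_imageD intro: inj_onI)
  have cardS: "card (S b) + card (S (\<not> b)) \<le> card F" for b
  proof -
    have "card (S b) + card (S (\<not> b))
        = card ((\<lambda>w. w @ [b]) ` S b \<union> (\<lambda>w. w @ [\<not> b]) ` S (\<not> b))"
      using finS by (subst card_Un_disjoint) (auto simp: card_image inj_on_def)
    also have "\<dots> \<le> card (c ` F)"
      using img[of b] img[of "\<not> b"] \<open>finite F\<close> by (intro card_mono) auto
    finally show ?thesis using card_image_le[OF \<open>finite F\<close>, of c] by linarith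
  qed
  have lenS: "length w = N" if "w \<in> S b" for w b
  proof -
    from that obtain K where "K \<in> F" "c K = w @ [b]" by (auto simp: S_def)
    with c(1)[of K] pverts[of K "c K"] n(1) show ?thesis by simp
  qed
  have SX: "S b \<subseteq> X b" for b
    using c(1) by (force simp: S_def X_def covered_verts_def)
  have XB: "X b \<subseteq> blocked (S b) (S (\<not> b)) {}" for b
  proof
    fix w assume "w \<in> X b"
    then obtain K where K: "K \<in> F" "w @ [b] \<in> pverts K" by (auto simp: X_def covered_verts_def)
    have "length (c K) = Suc N" using pverts[OF K(1) c(1)[OF K(1)]] n(1) by simp
    then obtain w0 b0 where cK: "c K = w0 @ [b0]" "length w0 = N"
      by (metis length_append_singleton nat.inject rev_exhaust list.size(3) nat.distinct(1))
    have w0: "w0 \<in> S b0" using cK(1) K(1) by (force simp: S_def)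
    have len: "length w = N" using pverts[OF K] n(1) by simp
    show "w \<in> blocked (S b) (S (\<not> b)) {}"
    proof (cases "w @ [b] = c K")
      case True
      with cK w0 show ?thesis by (auto simp: blocked_def)
    next
      case False
      with c(2)[OF K] cK n(1) have "(w0 @ [b0], w @ [b]) \<in> parcs (AQ (Suc N))" by simp
      with AQ_snoc_arcs[OF cK(2) len] have "if b = b0 then w \<in> nbrs w0 else w \<in> chain w0" by simp
      with w0 show ?thesis by (cases "b = b0") (auto simp: blocked_def)
    qed
  qed
  define V where "V = pverts (AQ n) - covered_verts F"
  have V_snoc: "w @ [b] \<in> V \<longleftrightarrow> length w = N \<and> w \<notin> X b" for w b
    by (auto simp: V_def pverts_AQ X_def n(1))
  have copy: "(w @ [b], w' @ [b]) \<in> rtrancl_on V (parcs (AQ n))"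
    if "w @ [b] \<in> V" "w' @ [b] \<in> V" for w w' b
  proof -
    have w: "length w = N" "length w' = N" "w \<notin> X b" "w' \<notin> X b" using that by (auto simp: V_snoc)
    \<comment> \<open>In copy \<open>b\<close>, members centred there act as stars, the others as
      chains. Each weighs 2 and there are no points.\<close>
    have "2 * card (S b) + 2 * card (S (\<not> b)) + card {} \<le> N - 1"
      using cardS[of b] t by simp
    from cube_minus_blocked_connected[OF finS finS finite.emptyI _ SX XB this w] lenS
    have "(w, w') \<in> rtrancl_on ({u. length u = N} - X b) cube_arcs" by blast
    then show ?thesis
      by (rule rtrancl_on_map)
        (auto simp: V_snoc cube_arcs_def n(1) AQ_snoc_arcs length_nbrs)
  qed
  obtain w where w: "\<And>b. w @ [b] \<in> V"
  proof -
    \<comment> \<open>Letting every centre serve both as a star and as a chain gives one set that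
      contains the deleted vertices of both copies.\<close>
    define U where "U = S True \<union> S False"
    have "card U \<le> card F"
      using card_Un_le[of "S True" "S False"] cardS[of True] by (simp add: U_def)
    have "card (blocked U U {}) \<le> (card U + card U) * Suc N + card ({} :: bool list set)"
      using finS lenS by (intro card_blocked_le) (auto simp: U_def)
    also have "\<dots> \<le> (2 * card F) * Suc N"
      using \<open>card U \<le> card F\<close> mult_le_mono1[of "card U + card U" "2 * card F" "Suc N"] by simp
    also have "\<dots> \<le> (N - 1) * Suc N" using t by (rule mult_le_mono1)
    also have "\<dots> < N * N" using n(2) by (cases N) auto
    also have "\<dots> \<le> 2 ^ N" using n(2) by (rule square_le_two_power)
    finally have "card (blocked U U {}) < 2 ^ N" .
    moreover have "finite (blocked U U {})" using finS by (intro finite_blocked) (auto simp: U_def)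
    ultimately have "\<not> {u. length u = N} \<subseteq> blocked U U {}"
      using card_mono[of "blocked U U {}" "{u. length u = N}"] by (auto simp: card_bool_lists)
    then obtain w where w: "length w = N" "w \<notin> blocked U U {}" by blast
    have "X b \<subseteq> blocked U U {}" for b
      using XB[of b] by (cases b) (auto simp: blocked_def U_def)
    with w that[of w] show ?thesis by (auto simp: V_snoc)
  qed
  have w_arc: "(w @ [b], w @ [\<not> b]) \<in> rtrancl_on V (parcs (AQ n))" for b
    using w[of b] w[of "\<not> b"] self_in_chain
    by (intro rtrancl_on_into_rtrancl_on[OF rtrancl_on_refl])
      (auto simp: n(1) V_snoc AQ_snoc_arcs)
  have reach: "(u, v) \<in> rtrancl_on V (parcs (AQ n))" if "u \<in> V" "v \<in> V" for u v
  proof -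
    have "\<exists>x b. z = x @ [b]" if "z \<in> V" for z
      using that n(1) by (cases z rule: rev_cases) (auto simp: V_def pverts_AQ)
    with that obtain x b y b' where uv: "u = x @ [b]" "v = y @ [b']" by meson
    show ?thesis
    proof (cases "b' = b")
      case True
      with that uv copy show ?thesis by simp
    next
      case False
      then have b': "b' = (\<not> b)" by blast
      have "(u, w @ [b]) \<in> rtrancl_on V (parcs (AQ n))" using that uv copy w by simp
      moreover have "(w @ [b], w @ [b']) \<in> rtrancl_on V (parcs (AQ n))" using w_arc b' by simp
      moreover have "(w @ [b'], v) \<in> rtrancl_on V (parcs (AQ n))" using that uv copy w by simp
      ultimately show ?thesis by (meson rtrancl_on_trans)
    qed
  qed
  have "connected (with_proj (AQ n) \<restriction> V)"
  proof -
    have "sym (arcs_ends (with_proj (AQ n) \<restriction> V))"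
      by (rule sym_arcs_ends_induced[OF pair_graph_AQ])
    moreover have "V \<noteq> {}" using w by blast
    moreover have "(u, v) \<in> rtrancl_on V (arcs_ends (with_proj (AQ n) \<restriction> V))"
      if "u \<in> V" "v \<in> V" for u v
      using reach[OF that]
      by induction (auto simp: arcs_ends_induced intro: converse_rtrancl_on_into_rtrancl_on that)
    ultimately show ?thesis by (simp add: connected_iff_symmetric)
  qed
  moreover have "card V \<noteq> 1"
    using w[of True] w[of False] by (auto simp: card_1_singleton_iff)
  ultimately show False
    using cut by (simp add: subgraph_cut_def V_def)
qed

subsection \<open>Isolating a vertex by stars\<close>

text \<open>One form for both the model \<open>star m\<close> and the stars inside an augmented
  cube.\<close>

definition star_at :: "'a \<Rightarrow> 'a set \<Rightarrow> 'a pair_pre_digraph" where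
  "star_at c L = \<lparr>pverts = insert c L, parcs = {c} \<times> L \<union> L \<times> {c}\<rparr>"

lemma star_eq_star_at: "star m = star_at 0 {1..m}"
  by (auto simp: star_def star_at_def)

lemma pair_graph_star_at:
  assumes "finite L" "c \<notin> L"
  shows "pair_graph (star_at c L)"
  using assms by unfold_locales
    (auto simp: star_at_def symmetric_def arcs_ends_with_proj sym_def)

lemma connected_star_at:
  assumes "finite L" "c \<notin> L"
  shows "connected (with_proj (star_at c L))"
proof -
  let ?V = "insert c L" and ?r = "{c} \<times> L \<union> L \<times> {c}"
  have to: "(u, c) \<in> rtrancl_on ?V ?r" and out: "(c, u) \<in> rtrancl_on ?V ?r" if "u \<in> ?V" for u
    using that rtrancl_on_into_rtrancl_on[OF rtrancl_on_refl, of u ?V c ?r]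
      rtrancl_on_into_rtrancl_on[OF rtrancl_on_refl, of c ?V u ?r] by auto
  have "(u, v) \<in> rtrancl_on ?V ?r" if "u \<in> ?V" "v \<in> ?V" for u v
    using rtrancl_on_trans[OF to[OF that(1)] out[OF that(2)]] .
  then show ?thesis
    using sym_parcs[OF pair_graph_star_at[OF assms]]
    by (simp add: connected_iff_symmetric arcs_ends_with_proj star_at_def)
qed

lemma undirected_subgraph_star_at:
  assumes "pair_graph G" "L \<subseteq> {v. (c, v) \<in> parcs G}" "c \<in> pverts G"
  shows "undirected_subgraph (star_at c L) G"
proof -
  interpret pair_graph G by fact
  have L: "L \<subseteq> pverts G" "c \<notin> L"
    using assms(2) in_arcsD2 no_loops' by fastforce+
  moreover from this have "finite L" using pair_finite_verts finite_subset by blast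
  ultimately have star: "pair_graph (star_at c L)" by (intro pair_graph_star_at)
  then interpret star: pair_graph "star_at c L" .
  have "parcs (star_at c L) \<subseteq> parcs G"
    using assms(2) sym_parcs[OF assms(1)] by (auto simp: star_at_def dest: symD)
  moreover have "pverts (star_at c L) \<subseteq> pverts G"
    using L assms(3) by (simp add: star_at_def)
  ultimately show ?thesis
    using star wf_digraph star.wf_digraph
    by (simp add: undirected_subgraph_def subgraph_def compatible_def)
qed

lemma star_at_iso:
  assumes "finite L" "finite L'" "c \<notin> L" "c' \<notin> L'" "card L = card L'"
  shows "digraph_iso (with_proj (star_at c L)) (with_proj (star_at c' L'))"
proof -
  interpret pair_graph "star_at c L" using assms by (intro pair_graph_star_at)
  obtain h where h: "bij_betw h L L'" using assms finite_same_card_bij by blast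
  define g where "g = h(c := c')"
  have gL: "g ` L = L'" "g c = c'"
    using h assms(3) by (auto simp: g_def bij_betw_def image_iff)
  have inj: "inj_on g (insert c L)"
    using h assms(3,4) by (auto simp: g_def bij_betw_def inj_on_def)
  define f where "f = \<lparr>iso_verts = g, iso_arcs = map_prod g g, iso_head = snd, iso_tail = fst\<rparr>"
  have "pre_digraph.digraph_isomorphism (with_proj (star_at c L)) f"
  proof -
    have "inj_on (map_prod g g) ({c} \<times> L \<union> L \<times> {c})"
      by (rule inj_on_subset[OF map_prod_inj_on[OF inj inj]]) auto
    then have "inj_on (iso_arcs f) (parcs (star_at c L))" "inj_on (iso_verts f) (pverts (star_at c L))"
      using inj by (simp_all add: f_def star_at_def)
    moreover have "iso_tail f (iso_arcs f e) = iso_verts f (fst e)"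
      "iso_head f (iso_arcs f e) = iso_verts f (snd e)" for e
      by (simp_all add: f_def)
    ultimately show ?thesis
      using wf_digraph by (simp add: pre_digraph.digraph_isomorphism_def)
  qed
  moreover have "with_proj (star_at c' L') = app_iso f (with_proj (star_at c L))"
    using gL by (auto simp: with_proj_def star_at_def app_iso_def f_def image_Un)
  ultimately show ?thesis by (auto simp: digraph_iso_def)
qed

lemma structure_cut_imp_substructure_cut:
  assumes "structure_cut G (star m) F"
  shows "substructure_cut G (star m) F"
proof -
  have "pair_graph (star m)" unfolding star_eq_star_at by (intro pair_graph_star_at) auto
  moreover from this interpret pair_graph "star m" .
  have "undirected_subgraph (star m) (star m)"
    using wf_digraph \<open>pair_graph (star m)\<close>
    by (simp add: undirected_subgraph_def subgraph_def compatible_def)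
  moreover have "connected (with_proj (star m))"
    unfolding star_eq_star_at by (intro connected_star_at) auto
  ultimately show ?thesis
    using assms unfolding structure_cut_def substructure_cut_def by blast
qed

section \<open>Bit flips and adjacencies between neighbours of a vertex\<close>

definition flip :: "nat \<Rightarrow> bool list \<Rightarrow> bool list" where
  "flip i u = u[i := \<not> u ! i]"

definition suffix_flip :: "nat \<Rightarrow> bool list \<Rightarrow> bool list" where
  "suffix_flip i u = take i u @ map Not (drop i u)"

lemma length_flip [simp]: "length (flip i u) = length u"
  by (simp add: flip_def)

lemma length_suffix_flip [simp]: "length (suffix_flip i u) = length u"
  by (simp add: suffix_flip_def)

lemma nth_flip: "j < length u \<Longrightarrow> flip i u ! j = (if j = i then \<not> u ! j else u ! j)"
  by (auto simp: flip_def nth_list_update)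

lemma nth_suffix_flip: "j < length u \<Longrightarrow> suffix_flip i u ! j = (if j < i then u ! j else \<not> u ! j)"
  by (auto simp: suffix_flip_def nth_append)

lemma AQ_arc_iff:
  "(u, v) \<in> parcs (AQ n) \<longleftrightarrow> length u = n \<and> (\<exists>i<n. v = flip i u \<or> v = suffix_flip i u)"
  by (simp add: parcs_AQ flip_def suffix_flip_def)

lemma suffix_flip_neq_self: "i < length u \<Longrightarrow> suffix_flip i u \<noteq> u"
  using nth_suffix_flip[of i u i] by auto

lemma flip_neq_self: "i < length u \<Longrightarrow> flip i u \<noteq> u"
  using nth_flip[of i u i] by auto

lemma flip_last: "Suc i = length u \<Longrightarrow> flip i u = suffix_flip i u"
  by (auto intro!: nth_equalityI simp: nth_flip nth_suffix_flip)

text \<open>The two strings differ in position \<open>i\<close> only.\<close>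

lemma suffix_flip_Suc_arcs:
  assumes "i < n" "length u = n"
  shows "(suffix_flip i u, suffix_flip (Suc i) u) \<in> parcs (AQ n)"
    and "(suffix_flip (Suc i) u, suffix_flip i u) \<in> parcs (AQ n)"
proof -
  have "suffix_flip (Suc i) u = flip i (suffix_flip i u)"
    "suffix_flip i u = flip i (suffix_flip (Suc i) u)"
    using assms by (auto intro!: nth_equalityI simp: nth_flip nth_suffix_flip less_Suc_eq split: if_splits)
  with assms show "(suffix_flip i u, suffix_flip (Suc i) u) \<in> parcs (AQ n)"
    "(suffix_flip (Suc i) u, suffix_flip i u) \<in> parcs (AQ n)"
    by (auto simp: AQ_arc_iff)
qed

text \<open>Flipping from \<open>i\<close> on and from \<open>Suc i\<close> on, in either order,
  changes position \<open>i\<close> alone. \<open>Suc i < n\<close> excludes the empty suffix, which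
  gives no arc.\<close>

lemma suffix_flip_flip_arcs:
  assumes "Suc i < n" "length u = n"
  shows "(suffix_flip i u, flip i u) \<in> parcs (AQ n)"
    and "(suffix_flip (Suc i) u, flip i u) \<in> parcs (AQ n)"
proof -
  have "flip i u = suffix_flip (Suc i) (suffix_flip i u)"
    "flip i u = suffix_flip i (suffix_flip (Suc i) u)"
    using assms by (auto intro!: nth_equalityI simp: nth_flip nth_suffix_flip less_Suc_eq split: if_splits)
  with assms show "(suffix_flip i u, flip i u) \<in> parcs (AQ n)"
    "(suffix_flip (Suc i) u, flip i u) \<in> parcs (AQ n)"
    unfolding AQ_arc_iff by (metis Suc_lessD length_suffix_flip)+
qed

section \<open>The upper bound\<close>

lemma card_AQ_nbrs_ge:
  assumes "length u = n"
  shows "n \<le> card {v. (u, v) \<in> parcs (AQ n)}"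
proof -
  interpret pair_graph "AQ n" by (rule pair_graph_AQ)
  have "{v. (u, v) \<in> parcs (AQ n)} \<subseteq> pverts (AQ n)" using in_arcsD2 by blast
  then have fin: "finite {v. (u, v) \<in> parcs (AQ n)}" using pair_finite_verts finite_subset by blast
  have "inj_on (\<lambda>i. flip i u) {..<n}"
    using assms by (intro inj_onI) (metis lessThan_iff nth_flip)
  then have "n = card ((\<lambda>i. flip i u) ` {..<n})" by (simp add: card_image)
  also have "\<dots> \<le> card {v. (u, v) \<in> parcs (AQ n)}"
    using fin assms by (intro card_mono) (auto simp: AQ_arc_iff)
  finally show ?thesis .
qed

lemma exists_isolating_stars:
  assumes "4 \<le> m" "m < n" and z: "length z = n"
  obtains F where "card F \<le> n div 2"
    and "\<And>K. K \<in> F \<Longrightarrow> undirected_subgraph K (AQ n) \<and> digraph_iso (with_proj K) (with_proj (star m))"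
    and "z \<notin> covered_verts F" and "{v. (z, v) \<in> parcs (AQ n)} \<subseteq> covered_verts F"
proof -
  interpret pair_graph "AQ n" by (rule pair_graph_AQ)
  define nb where "nb u = {v. (u, v) \<in> parcs (AQ n)}" for u
  have "nb u \<subseteq> pverts (AQ n)" for u unfolding nb_def using in_arcsD2 by blast
  then have fin: "finite (nb u)" for u using pair_finite_verts finite_subset by blast
  define c where "c j = suffix_flip (2 * j + 1) z" for j
  \<comment> \<open>The leaves each star must have. If \<open>2 * j + 2 = n\<close>, the third entry
    is \<open>z\<close> and the fourth is the centre; the intersection and the difference discard
    them.\<close>
  define base where "base j = ({suffix_flip (2 * j) z, flip (2 * j) z, suffix_flip (2 * j + 2) z,
    flip (2 * j + 1) z} \<inter> nb (c j)) - {z}" for j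
  have "\<exists>L. base j \<subseteq> L \<and> L \<subseteq> nb (c j) - {z} \<and> card L = m" for j
  proof (rule exists_subset_between)
    have "card (base j) \<le> card {suffix_flip (2 * j) z, flip (2 * j) z, suffix_flip (2 * j + 2) z,
        flip (2 * j + 1) z}"
      unfolding base_def by (intro card_mono) auto
    also have "\<dots> \<le> 4" by (simp add: card_insert_if)
    finally show "card (base j) \<le> m" using assms(1) by simp
    \<comment> \<open>At least \<open>n - 1 \<ge> m\<close> neighbours other than \<open>z\<close>
      remain, enough to extend \<open>base j\<close> to exactly \<open>m\<close> leaves.\<close>
    have "n \<le> card (nb (c j))" using z card_AQ_nbrs_ge[of "c j" n] by (simp add: nb_def c_def)
    then show "m \<le> card (nb (c j) - {z})"
      using assms(2) fin by (auto simp: card_Diff_singleton_if)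
  qed (auto simp: base_def fin)
  then obtain L where L: "\<And>j. base j \<subseteq> L j" "\<And>j. L j \<subseteq> nb (c j) - {z}" "\<And>j. card (L j) = m"
    by metis
  define F where "F = (\<lambda>j. star_at (c j) (L j)) ` {..<n div 2}"
  have finL: "finite (L j)" for j using L(2) fin finite_subset by (metis finite_Diff)
  have c_notin: "c j \<notin> L j" for j
    using L(2)[of j] no_loops' by (fastforce simp: nb_def)
  show ?thesis
  proof (rule that)
    show "card F \<le> n div 2" unfolding F_def using card_image_le[of "{..<n div 2}"] by simp
    show "undirected_subgraph K (AQ n) \<and> digraph_iso (with_proj K) (with_proj (star m))"
      if "K \<in> F" for K
    proof -
      from that obtain j where K: "K = star_at (c j) (L j)" by (auto simp: F_def)
      have "undirected_subgraph K (AQ n)" unfolding K using L(2)[of j] z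
        by (intro undirected_subgraph_star_at pair_graph_AQ) (auto simp: nb_def c_def pverts_AQ)
      moreover have "digraph_iso (with_proj K) (with_proj (star m))"
        unfolding K star_eq_star_at using L(3) finL c_notin by (intro star_at_iso) auto
      ultimately show ?thesis ..
    qed
    show "z \<notin> covered_verts F"
    proof
      assume "z \<in> covered_verts F"
      then obtain j where j: "j < n div 2" "z = c j \<or> z \<in> L j"
        by (auto simp: covered_verts_def F_def star_at_def)
      moreover have "c j \<noteq> z" unfolding c_def using j(1) z by (intro suffix_flip_neq_self) auto
      ultimately show False using L(2)[of j] by auto
    qed
    have covered: "v \<in> covered_verts F" if "j < n div 2" "v = c j \<or> v \<in> base j" for v j
      using that L(1)[of j] by (auto simp: covered_verts_def F_def star_at_def)
    have suffix: "suffix_flip i z \<in> covered_verts F" if i: "i < n" for i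
    proof -
      consider j where "i = 2 * j + 1" | j where "i = 2 * j" "2 * j + 1 < n"
        | j where "i = 2 * j" "2 * j + 1 = n"
      proof (cases "even i")
        case True
        then obtain j where "i = 2 * j" by (rule evenE)
        moreover from this have "2 * j + 1 < n \<or> 2 * j + 1 = n" using i by linarith
        ultimately show ?thesis using that by blast
      next
        case False
        then show ?thesis using that by (auto elim: oddE)
      qed
      then show ?thesis
      proof cases
        case (1 j)
        with i show ?thesis by (intro covered[of j]) (auto simp: c_def)
      next
        case (2 j)
        then have "suffix_flip i z \<in> base j"
          using suffix_flip_Suc_arcs(2)[of "2 * j" n z] suffix_flip_neq_self[of "2 * j" z] z
          by (auto simp: base_def nb_def c_def)
        with 2 show ?thesis by (intro covered[of j]) auto
      next
        \<comment> \<open>For odd \<open>n\<close> the last suffix flip has no star centred after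
          it; it is a leaf of the preceding star.\<close>
        case (3 j)
        with assms obtain k where k: "j = Suc k" by (cases j) auto
        then have "suffix_flip i z \<in> base k"
          using suffix_flip_Suc_arcs(1)[of "2 * k + 1" n z] suffix_flip_neq_self[of i z] z i 3
          by (auto simp: base_def nb_def c_def)
        with 3 k show ?thesis by (intro covered[of k]) auto
      qed
    qed
    have single: "flip i z \<in> covered_verts F" if i: "i < n" for i
    proof (cases "Suc i = n")
      case True
      then show ?thesis using flip_last[of i z] z suffix[OF i] by simp
    next
      case False
      then have i': "Suc i < n" using i by simp
      define j where "j = i div 2"
      then have j: "i = 2 * j \<or> i = 2 * j + 1" by linarith
      \<comment> \<open>For even \<open>i\<close> the centre is the suffix flip at
        \<open>Suc i\<close>, for odd \<open>i\<close> the one at \<open>i\<close>; both are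
        adjacent to \<open>flip i z\<close>.\<close>
      then have "flip i z \<in> base j"
        using suffix_flip_flip_arcs[OF i' z] flip_neq_self[of i z] z i
        by (auto simp: base_def nb_def c_def)
      with j i' show ?thesis by (intro covered[of j]) auto
    qed
    show "{v. (z, v) \<in> parcs (AQ n)} \<subseteq> covered_verts F"
      using suffix single by (auto simp: AQ_arc_iff)
  qed
qed

lemma exists_structure_cut:
  assumes "4 \<le> m" "m < n"
  obtains F where "structure_cut (AQ n) (star m) F" "card F \<le> n div 2"
proof -
  define z where "z = replicate n False"
  then have z: "length z = n" by simp
  obtain F where F: "card F \<le> n div 2"
    "\<And>K. K \<in> F \<Longrightarrow> undirected_subgraph K (AQ n) \<and> digraph_iso (with_proj K) (with_proj (star m))"
    "z \<notin> covered_verts F" "{v. (z, v) \<in> parcs (AQ n)} \<subseteq> covered_verts F"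
    using exists_isolating_stars[OF assms z] by blast
  define V where "V = pverts (AQ n) - covered_verts F"
  have zV: "z \<in> V" using z F(3) by (simp add: V_def pverts_AQ)
  \<comment> \<open>If \<open>z\<close> is the only vertex left, the cut is of the single-vertex
    kind; otherwise \<open>z\<close> is isolated from the rest.\<close>
  have "\<not> connected (with_proj (AQ n) \<restriction> V)" if "card V \<noteq> 1"
  proof
    assume conn: "connected (with_proj (AQ n) \<restriction> V)"
    have "V \<noteq> {z}" using that by auto
    with zV obtain v where v: "v \<in> V" "v \<noteq> z" by blast
    have "sym (arcs_ends (with_proj (AQ n) \<restriction> V))"
      by (rule sym_arcs_ends_induced[OF pair_graph_AQ])
    with conn zV v(1) have "(z, v) \<in> rtrancl_on V (arcs_ends (with_proj (AQ n) \<restriction> V))"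
      by (simp add: connected_iff_symmetric)
    from rtrancl_on_first_step[OF this] v(2) obtain y where "y \<in> V" "(z, y) \<in> parcs (AQ n)"
      by (auto simp: arcs_ends_induced)
    with F(4) show False by (auto simp: V_def)
  qed
  with F zV have "structure_cut (AQ n) (star m) F"
    unfolding structure_cut_def subgraph_cut_def Let_def V_def[symmetric] by auto
  with F(1) that show ?thesis by blast
qed

section \<open>Equality of both connectivities with the common bound\<close>

theorem theorem4p15:
  fixes m n :: nat
  assumes "4 \<le> m" and "real m \<le> (3 * real n - 15) / 4"
  shows "\<kappa>\<^sup>s(AQ n; star m) = \<kappa>(AQ n; star m)
    \<and> \<kappa>(AQ n; star m) = enat (nat \<lceil>(real n - 1) / 2\<rceil>)"
proof -
  have "real (4 * m) \<le> real (3 * n) - 15" using assms(2) by simp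
  then have "4 * m + 15 \<le> 3 * n" by linarith
  then have n: "5 \<le> n" "m < n" using assms(1) by linarith+
  \<comment> \<open>For \<open>n = 2 * k\<close> the value \<open>k - 1/2\<close> rounds up to
    \<open>k\<close>; for \<open>n = 2 * k + 1\<close> it is \<open>k\<close> exactly.\<close>
  have "\<lceil>(real n - 1) / 2\<rceil> = int (n div 2)"
  proof (cases "even n")
    case True
    then obtain k where "n = 2 * k" by (rule evenE)
    then show ?thesis by (intro ceiling_unique) auto
  next
    case False
    then obtain k where "n = 2 * k + 1" by (rule oddE)
    then show ?thesis by (intro ceiling_unique) auto
  qed
  then have half: "nat \<lceil>(real n - 1) / 2\<rceil> = n div 2" by simp
  have "enat (n div 2) \<le> \<kappa>\<^sup>s(AQ n; star m)"
    unfolding substructure_connectivity_def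
  proof (rule INF_greatest)
    fix F assume "F \<in> {F. substructure_cut (AQ n) (star m) F}"
    then have F: "subgraph_cut (AQ n) F" "\<And>K. K \<in> F \<Longrightarrow> \<exists>H. undirected_subgraph H (star m) \<and>
        connected (with_proj H) \<and> digraph_iso (with_proj K) (with_proj H)"
      by (auto simp: substructure_cut_def)
    have "\<forall>K\<in>F. \<exists>c\<in>pverts K. \<forall>v\<in>pverts K. v \<noteq> c \<longrightarrow> (c, v) \<in> parcs (AQ n)"
      using F star_substructure_center unfolding subgraph_cut_def by blast
    from half_dimension_le_card_cut[OF F(1) this n(1)]
    show "enat (n div 2) \<le> enat (card F)" by simp
  qed
  moreover have "\<kappa>\<^sup>s(AQ n; star m) \<le> \<kappa>(AQ n; star m)"
    unfolding substructure_connectivity_def structure_connectivity_def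
    by (rule INF_superset_mono) (auto intro: structure_cut_imp_substructure_cut)
  moreover have "\<kappa>(AQ n; star m) \<le> enat (n div 2)"
  proof -
    obtain F where F: "structure_cut (AQ n) (star m) F" "card F \<le> n div 2"
      using exists_structure_cut[OF assms(1) n(2)] .
    have "\<kappa>(AQ n; star m) \<le> enat (card F)"
      unfolding structure_connectivity_def using F(1) by (intro INF_lower) simp
    also have "\<dots> \<le> enat (n div 2)" using F(2) by simp
    finally show ?thesis .
  qed
  ultimately show ?thesis unfolding half by (metis order.antisym order.trans)
qed

end
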